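(* For any integer $k\geq 1$, $$G(z)=(\tau_{\beta,0}\circ\tau_{\beta,1}\circ\cdots\circ\tau_{\beta,k-1})(G_{k}(z)).$$ Thus $G(z)$ has the formal matrix continued fraction expansion (understood as the compositions of the transformations $\tau_{\beta,k}$ in the identities $G(z)=(\tau_{\beta,0}\circ\tau_{\beta,1}\circ\cdots\circ\tau_{\beta,k-1})(G_{k}(z))$, $k\geq 1$) $$G(z)=\cfrac{{\bf 1}}{\beta_{0}(z)+\beta^{+}_0\cfrac{{\bf 1}}{\beta_{1}(z)+\beta^{+}_1\cfrac{{\bf 1}}{\beta_{2}(z)+\beta^{+}_2\cfrac{{\bf 1}}{\beta_{3}(z)+\ddots}\,\beta^{-}_2}\,\beta^{-}_1}\,\beta^{-}_0}.$$
   Context: Fix integers $p,q\geq 1$ and, for each $-p\leq k\leq q$, a bi-infinite sequence $(a^{(k)}_{n})_{n\in\mathbb{Z}}$ of complex numbers. $\mathbb{C}((z^{-1}))$ is the field of formal series $\sum_{n\in\mathbb{Z}}a_nz^n$ with complex coefficients and only finitely many nonzero $a_n$ with $n>0$. Paths. A step is an ordered pair $(n,m)\rightarrow(n+1,m')$ with $n\in\mathbb{Z}_{\geq 0}$, $m,m'\in\mathbb{Z}$ and $-p\leq m'-m\leq q$. Its weight is $a_m^{(i)}$ if $m'=m+i$ with $0\leq i\leq q$, and $a_{m-j}^{(-j)}$ if $m'=m-j$ with $1\leq j\leq p$. A lattice path of length $k$ is a sequence of $k$ steps in which the final vertex of each step is the initial vertex of the next; a path of length zero is a single vertex. The weight $w(\gamma)$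 of a path is the product of the weights of its steps ($1$ for length zero). Empty sums are zero. For $n\geq 0$, $i,j\in\mathbb{Z}$, $\mathcal{P}_{[n,i,j]}$ is the collection of all lattice paths of length $n$ from $(0,i)$ to $(n,j)$; for $i,j\leq -1$, $\widehat{\mathcal{D}}_{[n,i,j]}\subset\mathcal{P}_{[n,i,j]}$ consists of the paths that never go above the line $y=-1$. Put $W_{[n,i,j]}=\sum_{\gamma\in\mathcal{P}_{[n,i,j]}}w(\gamma)$, $V_{[n,i,j]}=\sum_{\gamma\in\widehat{\mathcal{D}}_{[n,i,j]}}w(\gamma)$, and $$W_{i,j}(z)=\sum_{n=0}^\infty\frac{W_{[n,i,j]}}{z^{n+1}}\ (i,j\in\mathbb{Z}),\qquad V_{i,j}(z)=\sum_{n=0}^\infty\frac{V_{[n,i,j]}}{z^{n+1}}\ (i,j\leq -1).$$ $G(z)$ is the $q\times p$ matrix $(W_{i,j}(z))_{0\leq i\leq q-1,\,0\leq j\leq p-1}$. Pseudo-quotient. For a $q\times p$ matrix $A=(a_{i,j})_{0\leq i\leq q-1,\,0\leq j\leq p-1}$ over a field (here $\mathbb{C}((z^{-1}))$) with $a_{0,0}\neq 0$, let $T(A)=B=(b_{i,j})$ be the $q\times p$ matrix with $$b_{i,j}=\frac{a_{i+1,j+1}a_{0,0}-a_{0,j+1}a_{i+1,0}}{a_{0,0}}\ (0\leq i\leq q-2,\ 0\leq j\leq p-2),\quad b_{q-1,j}=-\frac{a_{0,j+1}}{a_{0,0}}\ (0\leq j\leq p-2),$$ $$b_{i,p-1}=\frac{a_{i+1,0}}{a_{0,0}}\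 (0\leq i\leq q-2),\qquad b_{q-1,p-1}=\frac{1}{a_{0,0}}.$$ $T$ is a bijection from matrices with $a_{0,0}\neq 0$ onto matrices with $b_{q-1,p-1}\neq 0$; write $A=\frac{\mathbf 1}{B}$ if $B=T(A)$. Coefficients. For $k\geq\min(p,q)$ put $d_k^{(i)}=a_k^{(i)}$ for $-p\leq i\leq q$. For $0\leq k\leq\min(p,q)-1$ put $$d^{(0)}_{k}=a^{(0)}_{k}+\sum_{l=1}^{p-k}\sum_{m=1}^{q-k}a^{(-(l+k))}_{-l}a^{(m+k)}_{-m}V_{-l,-m}(z),$$ $$d^{(i)}_{k}=a^{(i)}_{k}+\sum_{l=1}^{p-k}\sum_{m=1}^{q-(k+i)}a^{(-(l+k))}_{-l}a^{(m+k+i)}_{-m}V_{-l,-m}(z)\ (1\leq i\leq q-k-1),\quad d_k^{(i)}=a_k^{(i)}\ (q-k\leq i\leq q),$$ $$d^{(-j)}_{k}=a^{(-j)}_{k}+\sum_{l=1}^{p-(k+j)}\sum_{m=1}^{q-k}a^{(-(l+k+j))}_{-l}a^{(m+k)}_{-m}V_{-l,-m}(z)\ (1\leq j\leq p-k-1),\quad d_k^{(-j)}=a_k^{(-j)}\ (p-k\leq j\leq p),$$ where ranges of indices involving $i\ge1$, $j\ge1$ are implied. For $k\geq 0$: $\beta_k(z)$ is the $q\times p$ matrix whose only nonzero entry is $z-d_k^{(0)}$ in the bottom right corner; $\beta_k^+$ is the $q\times q$ matrix equal to the identity except that its last row is $(-d_k^{(1)},\ldots,-d_k^{(q)})$; $\beta_k^-$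 is the $p\times p$ matrix equal to the identity except that its last column is $(d_k^{(-1)},\ldots,d_k^{(-p)})^t$. For $q\times p$ matrices $X$, $$\tau_{\beta,k}(X)=\frac{\mathbf 1}{\beta_k(z)+\beta_k^+X\beta_k^-}.$$ The matrices $K$, $K_r$, $G_r$. Let $h_{i,j}=a^{(j-i)}_{\min(i,j)}$ if $-p\leq j-i\leq q$ and $h_{i,j}=0$ otherwise ($i,j\geq 0$). Let $K=(K_{i,j})_{i,j\geq 0}$ with $$K_{i,j}=h_{i,j}+\sum_{l=1}^{p-i}\sum_{m=1}^{q-j}a^{(-(l+i))}_{-l}a^{(m+j)}_{-m}V_{-l,-m}(z),\qquad 0\leq i\leq p-1,\ 0\leq j\leq q-1,$$ and $K_{i,j}=h_{i,j}$ otherwise. (Thus $d_k^{(i)}=K_{k,k+i}$ for $0\leq i\leq q$ and $d_k^{(-j)}=K_{k+j,k}$ for $1\leq j\leq p$.) For $r\geq 1$, $K_r$ is $K$ with its first $r$ rows and first $r$ columns deleted. Consider the ring (under usual matrix operations) of matrices $(f_{i,j}(z))_{i,j\geq 0}$ over $\mathbb{C}((z^{-1}))$ such that (1) there is $d\in\mathbb{Z}$ with $\deg f_{i,j}\leq d$ for all $i,j$, where $\deg$ is the largest exponent with nonzero coefficient, and (2) for every $n\leq d$ and $j\geq 0$ there is $\ell\geq 0$ such that the coefficient of $z^n$ in $f_{i,j}$ is zero for all $i\geq\ell$. The matrix $zI-K_r$ is invertible in this ring; $\zeta^{(r)}_{i,j}(z)$ denotes the $(i,j)$-entry of $(zI-K_r)^{-1}$,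 $i,j\geq 0$, and $$G_r(z)=(\zeta^{(r)}_{i,j}(z))_{0\leq i\leq q-1,\,0\leq j\leq p-1},\qquad r\geq 1.$$ *)

theory Defs
  imports
    "HOL-Computational_Algebra.Formal_Laurent_Series"
    "Jordan_Normal_Form.Matrix"
begin

text \<open>
  The field of formal series in \<open>z\<close> with finitely many positive powers is the type
  \<^typ>\<open>complex fls\<close>, where the formal variable \<^term>\<open>fls_X\<close> plays the role of \<open>1/z\<close>.
\<close>

abbreviation zvar :: "complex fls" where
  "zvar \<equiv> fls_X_inv"

definition zcoeff :: "complex fls \<Rightarrow> int \<Rightarrow> complex" where
  "zcoeff f n = fls_nth f (- n)"


text \<open>
  The sequences are given as \<open>a :: int \<Rightarrow> int \<Rightarrow> complex\<close>, with \<open>a i n\<close> for the \<open>n\<close>-th term of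
  the sequence with superscript \<open>i\<close>; only \<open>- p \<le> i \<le> q\<close> is ever used. A path is the nonempty
  list of its vertices, so a path of length \<open>n\<close> has \<open>n + 1\<close> vertices.
\<close>

type_synonym vertex = "nat \<times> int"

definition is_step :: "nat \<Rightarrow> nat \<Rightarrow> vertex \<Rightarrow> vertex \<Rightarrow> bool" where
  "is_step p q v w \<longleftrightarrow>
     fst w = fst v + 1 \<and> - int p \<le> snd w - snd v \<and> snd w - snd v \<le> int q"

definition step_weight :: "(int \<Rightarrow> int \<Rightarrow> complex) \<Rightarrow> vertex \<Rightarrow> vertex \<Rightarrow> complex" where
  "step_weight a v w =
     (let m = snd v; m' = snd w
      in if m \<le> m' then a (m' - m) m else a (- (m - m')) (m - (m - m')))"

definition is_path :: "nat \<Rightarrow> nat \<Rightarrow> vertex list \<Rightarrow> bool" where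
  "is_path p q vs \<longleftrightarrow> vs \<noteq> [] \<and> successively (is_step p q) vs"

definition path_length :: "vertex list \<Rightarrow> nat" where
  "path_length vs = length vs - 1"

definition path_weight :: "(int \<Rightarrow> int \<Rightarrow> complex) \<Rightarrow> vertex list \<Rightarrow> complex" where
  "path_weight a vs = (\<Prod>t<path_length vs. step_weight a (vs ! t) (vs ! Suc t))"

definition paths :: "nat \<Rightarrow> nat \<Rightarrow> nat \<Rightarrow> int \<Rightarrow> int \<Rightarrow> vertex list set" where
  "paths p q n i j =
     {vs. is_path p q vs \<and> path_length vs = n \<and> hd vs = (0, i) \<and> last vs = (n, j)}"

definition neg_paths :: "nat \<Rightarrow> nat \<Rightarrow> nat \<Rightarrow> int \<Rightarrow> int \<Rightarrow> vertex list set" where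
  "neg_paths p q n i j = {vs \<in> paths p q n i j. \<forall>v\<in>set vs. snd v \<le> - 1}"

definition W_coeff :: "nat \<Rightarrow> nat \<Rightarrow> (int \<Rightarrow> int \<Rightarrow> complex) \<Rightarrow> nat \<Rightarrow> int \<Rightarrow> int \<Rightarrow> complex" where
  "W_coeff p q a n i j = (\<Sum>\<gamma>\<in>paths p q n i j. path_weight a \<gamma>)"

definition V_coeff :: "nat \<Rightarrow> nat \<Rightarrow> (int \<Rightarrow> int \<Rightarrow> complex) \<Rightarrow> nat \<Rightarrow> int \<Rightarrow> int \<Rightarrow> complex" where
  "V_coeff p q a n i j = (\<Sum>\<gamma>\<in>neg_paths p q n i j. path_weight a \<gamma>)"

definition W_series :: "nat \<Rightarrow> nat \<Rightarrow> (int \<Rightarrow> int \<Rightarrow> complex) \<Rightarrow> int \<Rightarrow> int \<Rightarrow> complex fls" where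
  "W_series p q a i j = fls_X * fps_to_fls (Abs_fps (\<lambda>n. W_coeff p q a n i j))"

definition V_series :: "nat \<Rightarrow> nat \<Rightarrow> (int \<Rightarrow> int \<Rightarrow> complex) \<Rightarrow> int \<Rightarrow> int \<Rightarrow> complex fls" where
  "V_series p q a i j = fls_X * fps_to_fls (Abs_fps (\<lambda>n. V_coeff p q a n i j))"

definition G_mat :: "nat \<Rightarrow> nat \<Rightarrow> (int \<Rightarrow> int \<Rightarrow> complex) \<Rightarrow> complex fls mat" where
  "G_mat p q a = mat q p (\<lambda>(i, j). W_series p q a (int i) (int j))"


definition T_mat :: "'a::field mat \<Rightarrow> 'a mat" where
  "T_mat A =
     (let q = dim_row A; p = dim_col A
      in mat q p (\<lambda>(i, j).
           if i < q - 1 \<and> j < p - 1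
             then (A $$ (i + 1, j + 1) * A $$ (0, 0) - A $$ (0, j + 1) * A $$ (i + 1, 0))
                    / A $$ (0, 0)
           else if j < p - 1 then - (A $$ (0, j + 1) / A $$ (0, 0))
           else if i < q - 1 then A $$ (i + 1, 0) / A $$ (0, 0)
           else 1 / A $$ (0, 0)))"

definition is_pseudo_quotient :: "'a::field mat \<Rightarrow> 'a mat \<Rightarrow> bool" where
  "is_pseudo_quotient A B \<longleftrightarrow>
     0 < dim_row A \<and> 0 < dim_col A \<and> A $$ (0, 0) \<noteq> 0 \<and> B = T_mat A"

text \<open>
  The pseudo-quotient is a partial map; it is \<^term>\<open>None\<close> exactly where no \<open>A\<close> exists. This way an
  equation stating that a composition has the value \<^term>\<open>Some A\<close> includes the claim that every
  pseudo-quotient occurring in it is defined.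
\<close>

definition pseudo_quotient :: "'a::field mat \<rightharpoonup> 'a mat" where
  "pseudo_quotient B =
     (if \<exists>A. is_pseudo_quotient A B then Some (THE A. is_pseudo_quotient A B) else None)"

definition mcf_step :: "'a::field mat \<Rightarrow> 'a mat \<Rightarrow> 'a mat \<Rightarrow> 'a mat \<rightharpoonup> 'a mat" where
  "mcf_step b bp bm X = pseudo_quotient (b + bp * X * bm)"

definition compose_first :: "nat \<Rightarrow> (nat \<Rightarrow> 'b \<rightharpoonup> 'b) \<Rightarrow> 'b \<rightharpoonup> 'b" where
  "compose_first k t = foldr (\<circ>\<^sub>m) (map t [0..<k]) Some"

text \<open>
  The formal expansion of \<open>A\<close> with coefficients \<open>b\<close>, \<open>bp\<close>, \<open>bm\<close> and remainders \<open>R\<close>: for every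
  \<open>k \<ge> 1\<close>, the fraction truncated at level \<open>k\<close> with innermost argument \<open>R k\<close> equals \<open>A\<close>.
\<close>

definition has_formal_mcf ::
  "(nat \<Rightarrow> 'a::field mat) \<Rightarrow> (nat \<Rightarrow> 'a mat) \<Rightarrow> (nat \<Rightarrow> 'a mat) \<Rightarrow> (nat \<Rightarrow> 'a mat) \<Rightarrow> 'a mat \<Rightarrow> bool" where
  "has_formal_mcf b bp bm R A \<longleftrightarrow>
     (\<forall>k\<ge>1. compose_first k (\<lambda>r. mcf_step (b r) (bp r) (bm r)) (R k) = Some A)"


definition d_coeff :: "nat \<Rightarrow> nat \<Rightarrow> (int \<Rightarrow> int \<Rightarrow> complex) \<Rightarrow> int \<Rightarrow> int \<Rightarrow> complex fls" where
  "d_coeff p q a k i =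
     (if k \<ge> int (min p q) then fls_const (a i k)
      else if i = 0 then
        fls_const (a 0 k) +
        (\<Sum>l=1..int p - k. \<Sum>m=1..int q - k.
           fls_const (a (- (l + k)) (- l) * a (m + k) (- m)) * V_series p q a (- l) (- m))
      else if 0 < i then
        (if i \<le> int q - k - 1 then
           fls_const (a i k) +
           (\<Sum>l=1..int p - k. \<Sum>m=1..int q - (k + i).
              fls_const (a (- (l + k)) (- l) * a (m + k + i) (- m)) * V_series p q a (- l) (- m))
         else fls_const (a i k))
      else
        (let j = - i in
         if j \<le> int p - k - 1 then
           fls_const (a (- j) k) +
           (\<Sum>l=1..int p - (k + j). \<Sum>m=1..int q - k.
              fls_const (a (- (l + k + j)) (- l) * a (m + k) (- m)) * V_series p q a (- l) (- m))
         else fls_const (a (- j) k)))"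

definition beta :: "nat \<Rightarrow> nat \<Rightarrow> (int \<Rightarrow> int \<Rightarrow> complex) \<Rightarrow> nat \<Rightarrow> complex fls mat" where
  "beta p q a k = mat q p (\<lambda>(i, j).
     if i = q - 1 \<and> j = p - 1 then zvar - d_coeff p q a (int k) 0 else 0)"

definition beta_plus :: "nat \<Rightarrow> nat \<Rightarrow> (int \<Rightarrow> int \<Rightarrow> complex) \<Rightarrow> nat \<Rightarrow> complex fls mat" where
  "beta_plus p q a k = mat q q (\<lambda>(i, j).
     if i = q - 1 then - d_coeff p q a (int k) (int j + 1) else if i = j then 1 else 0)"

definition beta_minus :: "nat \<Rightarrow> nat \<Rightarrow> (int \<Rightarrow> int \<Rightarrow> complex) \<Rightarrow> nat \<Rightarrow> complex fls mat" where
  "beta_minus p q a k = mat p p (\<lambda>(i, j).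
     if j = p - 1 then d_coeff p q a (int k) (- (int i + 1)) else if i = j then 1 else 0)"

definition tau ::
  "nat \<Rightarrow> nat \<Rightarrow> (int \<Rightarrow> int \<Rightarrow> complex) \<Rightarrow> nat \<Rightarrow> complex fls mat \<rightharpoonup> complex fls mat" where
  "tau p q a k = mcf_step (beta p q a k) (beta_plus p q a k) (beta_minus p q a k)"


type_synonym inf_mat = "nat \<Rightarrow> nat \<Rightarrow> complex fls"

text \<open>
  The infinite sum in the product is taken in the \<^typ>\<open>complex fls\<close> topology of the library (that of
  formal series, in which large powers of \<open>1/z\<close> are small). On the carrier, it converges: each
  coefficient of the sum receives only finitely many nonzero contributions.
\<close>

definition inf_mat_ring :: "inf_mat ring" where
  "inf_mat_ring =
     \<lparr>carrier = {f. \<exists>d. (\<forall>i j. \<forall>n>d. zcoeff (f i j) n = 0) \<and>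
                       (\<forall>n\<le>d. \<forall>j. \<exists>l. \<forall>i\<ge>l. zcoeff (f i j) n = 0)},
      mult = (\<lambda>f g i j. \<Sum>k. f i k * g k j),
      one = (\<lambda>i j. if i = j then 1 else 0),
      zero = (\<lambda>i j. 0),
      add = (\<lambda>f g i j. f i j + g i j)\<rparr>"

definition h_entry :: "nat \<Rightarrow> nat \<Rightarrow> (int \<Rightarrow> int \<Rightarrow> complex) \<Rightarrow> nat \<Rightarrow> nat \<Rightarrow> complex" where
  "h_entry p q a i j =
     (if - int p \<le> int j - int i \<and> int j - int i \<le> int q
      then a (int j - int i) (int (min i j)) else 0)"

definition K_mat :: "nat \<Rightarrow> nat \<Rightarrow> (int \<Rightarrow> int \<Rightarrow> complex) \<Rightarrow> inf_mat" where
  "K_mat p q a i j =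
     (if i < p \<and> j < q then
        fls_const (h_entry p q a i j) +
        (\<Sum>l=1..int p - int i. \<Sum>m=1..int q - int j.
           fls_const (a (- (l + int i)) (- l) * a (m + int j) (- m)) * V_series p q a (- l) (- m))
      else fls_const (h_entry p q a i j))"

definition K_trunc :: "nat \<Rightarrow> nat \<Rightarrow> (int \<Rightarrow> int \<Rightarrow> complex) \<Rightarrow> nat \<Rightarrow> inf_mat" where
  "K_trunc p q a r i j = K_mat p q a (r + i) (r + j)"

definition z_minus :: "inf_mat \<Rightarrow> inf_mat" where
  "z_minus M i j = (if i = j then zvar else 0) - M i j"

definition zeta :: "nat \<Rightarrow> nat \<Rightarrow> (int \<Rightarrow> int \<Rightarrow> complex) \<Rightarrow> nat \<Rightarrow> inf_mat" where
  "zeta p q a r = inv\<^bsub>inf_mat_ring\<^esub> (z_minus (K_trunc p q a r))"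

definition G_rem :: "nat \<Rightarrow> nat \<Rightarrow> (int \<Rightarrow> int \<Rightarrow> complex) \<Rightarrow> nat \<Rightarrow> complex fls mat" where
  "G_rem p q a r = mat q p (\<lambda>(i, j). zeta p q a r i j)"

end

theory Submission
  imports Defs
begin

text \<open>
  A row \<open>X\<close> of series of bounded degree is determined by an equation \<open>z X = f + X K\<close> with \<open>K\<close>
  column-finite and without positive powers of \<open>z\<close>, because \<open>X = (f + X K) / z\<close> fixes its
  coefficients one after the other. The identities needed all follow from this uniqueness. Splitting off the
  first row and column of \<open>z - K\<^sub>r\<close> (Schur complement) expresses the inverse of \<open>z - K\<^sub>r\<close> through that of
  \<open>z - K\<^sub>r\<^sub>+\<^sub>1\<close>, and the resulting formulas say exactly that \<open>T\<close> maps \<open>G\<^sub>r\<close> to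
  \<open>\<beta>\<^sub>r + \<beta>\<^sub>r\<^sup>+ G\<^sub>r\<^sub>+\<^sub>1 \<beta>\<^sub>r\<^sup>-\<close>. Decomposing paths by their last step shows that the \<open>W\<^sub>i\<^sub>,\<^sub>j\<close> satisfy a row
  equation over all integers; eliminating the negative indices turns its matrix into \<open>K\<close>, so that
  \<open>G\<close> is the corner of the inverse of \<open>z - K\<close>.
\<close>

section \<open>Row equations over formal Laurent series\<close>

text \<open>As \<open>fls_X\<close> is 1/z, this bounds the degree in \<open>z\<close> by
  \<open>- d\<close>; the zero series satisfies every such bound.\<close>

definition vanishes_below :: "int \<Rightarrow> complex fls \<Rightarrow> bool" where
  "vanishes_below d f \<longleftrightarrow> (\<forall>m<d. fls_nth f m = 0)"

lemma vanishes_below_mono: "vanishes_below d f \<Longrightarrow> e \<le> d \<Longrightarrow> vanishes_below e f"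
  by (auto simp: vanishes_below_def)

lemma vanishes_below_0 [simp]: "vanishes_below d 0"
  by (simp add: vanishes_below_def)

lemma vanishes_below_1 [simp]: "d \<le> 0 \<Longrightarrow> vanishes_below d 1"
  by (simp add: vanishes_below_def)

lemma vanishes_below_const [simp]: "d \<le> 0 \<Longrightarrow> vanishes_below d (fls_const c)"
  by (simp add: vanishes_below_def)

lemma vanishes_below_add: "vanishes_below d f \<Longrightarrow> vanishes_below d g \<Longrightarrow> vanishes_below d (f + g)"
  by (simp add: vanishes_below_def)

lemma vanishes_below_diff: "vanishes_below d f \<Longrightarrow> vanishes_below d g \<Longrightarrow> vanishes_below d (f - g)"
  by (simp add: vanishes_below_def)

lemma vanishes_below_sum:
  "(\<And>k. k \<in> S \<Longrightarrow> vanishes_below d (f k)) \<Longrightarrow> vanishes_below d (\<Sum>k\<in>S. f k)"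
  by (induction S rule: infinite_finite_induct) (auto intro: vanishes_below_add)

lemma vanishes_below_mult:
  assumes "vanishes_below d f" "vanishes_below e g"
  shows "vanishes_below (d + e) (f * g)"
proof (cases "f = 0 \<or> g = 0")
  case False
  have "d \<le> fls_subdegree f" "e \<le> fls_subdegree g"
    using assms False unfolding vanishes_below_def
    by (metis linorder_not_less nth_fls_subdegree_nonzero)+
  then show ?thesis
    by (auto simp: vanishes_below_def intro!: fls_times_nth_eq0)
qed auto

lemma vanishes_below_mult_0:
  "vanishes_below d f \<Longrightarrow> vanishes_below 0 g \<Longrightarrow> vanishes_below d (f * g)"
  using vanishes_below_mult[of d f 0 g] by simp

lemma vanishes_below_X_times_fps [simp]:
  "d \<le> 1 \<Longrightarrow> vanishes_below d (fls_X * fps_to_fls f)"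
  by (simp add: vanishes_below_def fls_X_times_conv_shift)

lemma zvar_times_X [simp]: "zvar * (fls_X * f) = f"
  by (simp add: fls_X_inv_times_conv_shift fls_X_times_conv_shift)

lemma fps_to_fls_sum: "fps_to_fls (\<Sum>k\<in>S. f k) = (\<Sum>k\<in>S. fps_to_fls (f k))"
  by (induction S rule: infinite_finite_induct) simp_all

text \<open>The right side vanishes to the same order as the \<open>X k\<close>, since the
  \<open>A k j\<close> have no positive powers of \<open>z\<close>; cancelling \<open>z\<close>
  gains one order, and iteration leaves only zero. The bound \<open>d\<close> is common to all of
  \<open>I\<close> because the estimate for \<open>X j\<close> draws on those for all
  \<open>X k\<close> with \<open>k\<close> in \<open>S j\<close>.\<close>

lemma homogeneous_row_equation:
  fixes X :: "'i \<Rightarrow> complex fls"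
  assumes eq: "\<And>j. j \<in> I \<Longrightarrow> zvar * X j = (\<Sum>k\<in>S j. X k * A k j)"
    and sub: "\<And>j. j \<in> I \<Longrightarrow> S j \<subseteq> I"
    and A: "\<And>j k. j \<in> I \<Longrightarrow> k \<in> S j \<Longrightarrow> vanishes_below 0 (A k j)"
    and X: "\<And>j. j \<in> I \<Longrightarrow> vanishes_below d (X j)"
    and j: "j \<in> I"
  shows "X j = 0"
proof -
  have *: "vanishes_below (d + int n) (X j)" if "j \<in> I" for n j
    using that
  proof (induction n arbitrary: j)
    case (Suc n)
    have "vanishes_below (d + int n) (zvar * X j)"
      unfolding eq[OF Suc.prems]
      using Suc sub A by (intro vanishes_below_sum vanishes_below_mult_0) blast+
    then have "fls_nth (X j) (m - 1 + 1) = 0" if "m - 1 < d + int n" for m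
      using that unfolding vanishes_below_def fls_X_inv_times_conv_shift fls_shift_nth by blast
    then show ?case by (simp add: vanishes_below_def)
  qed (simp add: X)
  have "fls_nth (X j) m = 0" for m
  proof -
    \<comment> \<open>After this many rounds the bound exceeds \<open>m\<close>; for
      \<open>m < d\<close> zero rounds suffice.\<close>
    have "vanishes_below (d + int (nat (m - d + 1))) (X j)" by (rule *[OF j])
    then show ?thesis by (simp add: vanishes_below_def)
  qed
  then show ?thesis by (simp add: fls_eq_iff)
qed

section \<open>Resolvents of banded matrices\<close>

text \<open>The band keeps all row and column sums finite, and the absence of positive powers of
  \<open>z\<close> makes \<open>homogeneous_row_equation\<close> applicable.\<close>

definition banded :: "nat \<Rightarrow> nat \<Rightarrow> inf_mat \<Rightarrow> bool" where
  "banded p q K \<longleftrightarrow> (\<forall>i j. vanishes_below 0 (K i j) \<and> (K i j \<noteq> 0 \<longrightarrow> j \<le> i + q \<and> i \<le> j + p))"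

text \<open>For \<open>A\<close> with \<open>p\<close> subdiagonals, the coefficient of
  \<open>z^(-n)\<close> in entry \<open>(i, j)\<close> of the inverse of \<open>z - A\<close>, read
  off from \<open>L = (1 + L A) / z\<close>; the division by \<open>z\<close> is the shift to
  \<open>Suc n\<close>.\<close>

fun resolvent_coeff :: "nat \<Rightarrow> (nat \<Rightarrow> nat \<Rightarrow> complex fps) \<Rightarrow> nat \<Rightarrow> nat \<Rightarrow> nat \<Rightarrow> complex" where
  "resolvent_coeff p A 0 i j = 0"
| "resolvent_coeff p A (Suc n) i j = (if n = 0 \<and> i = j then 1 else 0) +
     (\<Sum>k\<le>j + p. \<Sum>m=0..n. resolvent_coeff p A m i k * fps_nth (A k j) (n - m))"


text \<open>One level of the recursion passes from column \<open>j\<close> to columns up to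
  \<open>j + p\<close>, so \<open>n\<close> levels cannot reach the diagonal entry in column
  \<open>i\<close>. This yields the column condition of \<open>inf_mat_ring\<close>.\<close>

lemma resolvent_coeff_eq_0: "j + n * p < i \<Longrightarrow> resolvent_coeff p A n i j = 0"
proof (induction n arbitrary: j rule: less_induct)
  case (less n)
  show ?case
  proof (cases n)
    case (Suc n')
    have "resolvent_coeff p A m i k = 0" if "k \<le> j + p" "m \<le> n'" for k m
    proof (rule less.IH)
      have "m * p \<le> n' * p" using that by (intro mult_le_mono1)
      moreover have "j + p + n' * p < i" using less.prems Suc by simp
      ultimately show "k + m * p < i" using that by linarith
    qed (use that Suc in simp)
    then show ?thesis using less.prems Suc by (auto intro!: sum.neutral)
  qed simp
qed

lemma bandedD:
  assumes "banded p q K"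
  shows "vanishes_below 0 (K i j)" "i + q < j \<Longrightarrow> K i j = 0" "j + p < i \<Longrightarrow> K i j = 0"
  using assms unfolding banded_def by (metis linorder_not_le)+

lemma ex_left_resolvent:
  assumes K: "banded p q K"
  obtains L where
    "\<And>i j. zvar * L i j = (if i = j then 1 else 0) + (\<Sum>k\<le>j + p. L i k * K k j)"
    "\<And>i j. vanishes_below 1 (L i j)"
    "\<And>i j m. j + nat m * p < i \<Longrightarrow> fls_nth (L i j) m = 0"
proof
  define A where "A i j = fls_regpart (K i j)" for i j
  have KA: "K i j = fps_to_fls (A i j)" for i j
    using bandedD(1)[OF K, of i j] by (auto simp: A_def fls_eq_iff vanishes_below_def)
  \<comment> \<open>\<open>F\<close> is \<open>z\<close> times the wanted \<open>L\<close>; the zero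
    coefficient 0 of \<open>L\<close> matches the start value of
    \<open>resolvent_coeff\<close>.\<close>
  define F where "F i j = Abs_fps (\<lambda>n. resolvent_coeff p A (Suc n) i j)" for i j
  define L where "L i j = fls_X * fps_to_fls (F i j)" for i j
  have F: "F i j = (if i = j then 1 else 0) + (\<Sum>k\<le>j + p. fps_X * F i k * A k j)" for i j
  proof (rule fps_ext)
    fix n
    have "fps_nth (fps_X * F i k * A k j) n =
        (\<Sum>m=0..n. resolvent_coeff p A m i k * fps_nth (A k j) (n - m))" for k
      unfolding fps_mult_nth
    proof (rule sum.cong)
      fix m assume "m \<in> {0..n}"
      show "(\<Sum>l=0..m. fps_nth fps_X l * fps_nth (F i k) (m - l)) * fps_nth (A k j) (n - m) =
        resolvent_coeff p A m i k * fps_nth (A k j) (n - m)"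
        unfolding fps_mult_nth[symmetric] by (cases m) (simp_all add: F_def)
    qed simp
    then show "fps_nth (F i j) n =
        fps_nth ((if i = j then 1 else 0) + (\<Sum>k\<le>j + p. fps_X * F i k * A k j)) n"
      by (simp add: F_def fps_sum_nth)
  qed
  show "zvar * L i j = (if i = j then 1 else 0) + (\<Sum>k\<le>j + p. L i k * K k j)" for i j
  proof -
    have "fps_to_fls (F i j) = (if i = j then 1 else 0) + (\<Sum>k\<le>j + p. L i k * K k j)"
      by (subst F) (simp add: KA L_def fps_to_fls_sum fls_times_fps_to_fls)
    then show ?thesis by (simp add: L_def)
  qed
  show "vanishes_below 1 (L i j)" for i j
    by (simp add: L_def)
  show "fls_nth (L i j) m = 0" if "j + nat m * p < i" for i j m
  proof (cases "m \<le> 0")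
    case False
    then have "Suc (nat (m - 1)) = nat m" by simp
    then have "resolvent_coeff p A (Suc (nat (m - 1))) i j = 0"
      using that by (metis resolvent_coeff_eq_0)
    then show ?thesis using False by (simp add: L_def fls_X_times_conv_shift F_def)
  qed (simp add: L_def fls_X_times_conv_shift)
qed

lemma row_equation_unique:
  assumes K: "banded p q K"
    and X: "\<And>j. zvar * X j = f j + (\<Sum>k\<le>j + p. X k * K k j)" "\<And>j. vanishes_below d (X j)"
    and Y: "\<And>j. zvar * Y j = f j + (\<Sum>k\<le>j + p. Y k * K k j)" "\<And>j. vanishes_below e (Y j)"
  shows "X j = Y j"
proof -
  have "X j - Y j = 0"
  proof (rule homogeneous_row_equation[where I = UNIV and A = K and S = "\<lambda>j. {..j + p}" and d = "min d e"])
    show "zvar * (X j - Y j) = (\<Sum>k\<le>j + p. (X k - Y k) * K k j)" for j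
      by (simp add: right_diff_distrib X(1) Y(1) left_diff_distrib sum_subtractf)
    show "vanishes_below (min d e) (X j - Y j)" for j
      using X(2)[of j] Y(2)[of j] by (auto intro!: vanishes_below_diff elim: vanishes_below_mono)
  qed (use bandedD(1)[OF K] in auto)
  then show ?thesis by simp
qed

text \<open>Put \<open>D = (z - K) L - 1\<close>. Then
  \<open>D (z - K) = (z - K) (L (z - K) - 1) = 0\<close>, so each row of \<open>D\<close> solves the
  homogeneous row equation.\<close>

lemma left_resolvent_imp_right_resolvent:
  assumes K: "banded p q K"
    and L: "\<And>i j. zvar * L i j = (if i = j then 1 else 0) + (\<Sum>k\<le>j + p. L i k * K k j)"
    and L': "\<And>i j. vanishes_below 1 (L i j)"
  shows "zvar * L i j = (if i = j then 1 else 0) + (\<Sum>k\<le>i + q. K i k * L k j)"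
proof -
  define D where "D j = zvar * L i j - (if i = j then 1 else 0) - (\<Sum>k\<le>i + q. K i k * L k j)" for j
  have "D j = 0"
  proof (rule homogeneous_row_equation[where I = UNIV and A = K and S = "\<lambda>j. {..j + p}" and d = 0])
    fix j
    \<comment> \<open>If the index of the delta lies outside the summation range,
      \<open>K i j\<close> vanishes by the band condition.\<close>
    have Kij: "(\<Sum>l\<le>j + p. (if i = l then 1 else 0) * K l j) = K i j"
      using bandedD(3)[OF K] by (simp add: if_distrib[of "\<lambda>x. x * _"] not_le cong: if_cong)
    have Kij': "(\<Sum>k\<le>i + q. K i k * (if k = j then 1 else 0)) = K i j"
      using bandedD(2)[OF K] by (simp add: if_distrib[of "\<lambda>x. _ * x"] not_le cong: if_cong)
    have "zvar * D j = zvar * (zvar * L i j) - zvar * (if i = j then 1 else 0) -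
        (\<Sum>k\<le>i + q. K i k * (zvar * L k j))"
      unfolding D_def by (simp only: right_diff_distrib sum_distrib_left mult.left_commute)
    also have "zvar * (zvar * L i j) =
        zvar * (if i = j then 1 else 0) + (\<Sum>l\<le>j + p. (zvar * L i l) * K l j)"
      by (subst L) (simp only: distrib_left sum_distrib_left mult.assoc)
    also have "(\<Sum>k\<le>i + q. K i k * (zvar * L k j)) =
        K i j + (\<Sum>k\<le>i + q. \<Sum>l\<le>j + p. K i k * L k l * K l j)"
      unfolding L distrib_left sum.distrib Kij' by (simp only: sum_distrib_left mult.assoc)
    also have "(\<Sum>k\<le>i + q. \<Sum>l\<le>j + p. K i k * L k l * K l j) =
        (\<Sum>l\<le>j + p. (\<Sum>k\<le>i + q. K i k * L k l) * K l j)"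
      by (subst sum.swap) (simp only: sum_distrib_right)
    also have "zvar * (if i = j then 1 else 0) + (\<Sum>l\<le>j + p. (zvar * L i l) * K l j) -
        zvar * (if i = j then 1 else 0) -
        (K i j + (\<Sum>l\<le>j + p. (\<Sum>k\<le>i + q. K i k * L k l) * K l j)) = (\<Sum>l\<le>j + p. D l * K l j)"
      unfolding D_def left_diff_distrib sum_subtractf Kij by simp
    finally show "zvar * D j = (\<Sum>l\<le>j + p. D l * K l j)" .
  next
    fix j
    have "vanishes_below 0 (zvar * L i j)"
      using L'[of i j] by (simp add: vanishes_below_def fls_X_inv_times_conv_shift)
    moreover have "vanishes_below 0 (K i k * L k j)" for k
      using bandedD(1)[OF K] vanishes_below_mono[OF L'] by (intro vanishes_below_mult_0) simp_all
    ultimately show "vanishes_below 0 (D j)"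
      unfolding D_def by (auto intro!: vanishes_below_diff vanishes_below_sum)
  qed (use bandedD(1)[OF K] in auto)
  then show ?thesis by (simp add: D_def algebra_simps)
qed

text \<open>The band leaves finitely many nonzero terms in the infinite sum of the ring product,
  whatever \<open>y\<close> is.\<close>

lemma mult_z_minus:
  assumes K: "banded p q K"
  shows "(y \<otimes>\<^bsub>inf_mat_ring\<^esub> z_minus K) i j = zvar * y i j - (\<Sum>k\<le>j + p. y i k * K k j)"
proof -
  have "(\<Sum>k. y i k * z_minus K k j) = (\<Sum>k\<le>j + p. y i k * z_minus K k j)"
    by (rule suminf_finite) (use bandedD(3)[OF K] in \<open>auto simp: z_minus_def\<close>)
  also have "\<dots> = (\<Sum>k\<le>j + p. (if k = j then y i k * zvar else 0) - y i k * K k j)"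
    by (intro sum.cong) (auto simp: z_minus_def algebra_simps)
  also have "\<dots> = zvar * y i j - (\<Sum>k\<le>j + p. y i k * K k j)"
    by (simp add: sum_subtractf mult.commute)
  finally show ?thesis by (simp add: inf_mat_ring_def)
qed

lemma z_minus_mult:
  assumes K: "banded p q K"
  shows "(z_minus K \<otimes>\<^bsub>inf_mat_ring\<^esub> y) i j = zvar * y i j - (\<Sum>k\<le>i + q. K i k * y k j)"
proof -
  have "(\<Sum>k. z_minus K i k * y k j) = (\<Sum>k\<le>i + q. z_minus K i k * y k j)"
    by (rule suminf_finite) (use bandedD(2)[OF K] in \<open>auto simp: z_minus_def\<close>)
  also have "\<dots> = (\<Sum>k\<le>i + q. (if i = k then zvar * y k j else 0) - K i k * y k j)"
    by (intro sum.cong) (auto simp: z_minus_def algebra_simps)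
  also have "\<dots> = zvar * y i j - (\<Sum>k\<le>i + q. K i k * y k j)"
    by (simp add: sum_subtractf)
  finally show ?thesis by (simp add: inf_mat_ring_def)
qed

abbreviation resolvent :: "inf_mat \<Rightarrow> inf_mat" where
  "resolvent K \<equiv> inv\<^bsub>inf_mat_ring\<^esub> (z_minus K)"

text \<open>\<open>m_inv\<close> is a definite description, so its value is pinned down by a
  two-sided inverse in the carrier together with uniqueness; the latter comes from the row equations
  instead of ring axioms.\<close>

lemma resolvent_row:
  assumes K: "banded p q K"
  shows "zvar * resolvent K i j = (if i = j then 1 else 0) + (\<Sum>k\<le>j + p. resolvent K i k * K k j)"
      (is ?eq)
    and "vanishes_below 1 (resolvent K i j)" (is ?vb)
proof -
  obtain L where L: "\<And>i j. zvar * L i j = (if i = j then 1 else 0) + (\<Sum>k\<le>j + p. L i k * K k j)"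
    "\<And>i j. vanishes_below 1 (L i j)" "\<And>i j m. j + nat m * p < i \<Longrightarrow> fls_nth (L i j) m = 0"
    using ex_left_resolvent[OF K] by metis
  have "resolvent K = L"
    unfolding m_inv_def
  proof (rule the_equality)
    have one: "\<one>\<^bsub>inf_mat_ring\<^esub> = (\<lambda>i j. if i = j then 1 else 0)"
      by (simp add: inf_mat_ring_def)
    have "L \<in> carrier inf_mat_ring"
      unfolding inf_mat_ring_def partial_object.select_convs mem_Collect_eq
    \<comment> \<open>All entries of \<open>L\<close> have degree at most -1, so 0 is a degree
      bound.\<close>
    proof (intro exI[of _ "0::int"] conjI allI impI)
      show "zcoeff (L i j) n = 0" if "0 < n" for n i j
        using L(2) that by (simp add: zcoeff_def vanishes_below_def)
      show "\<exists>l. \<forall>i\<ge>l. zcoeff (L i j) n = 0" for n j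
        using L(3) by (auto simp: zcoeff_def intro!: exI[of _ "Suc (j + nat (- n) * p)"])
    qed
    moreover have "L \<otimes>\<^bsub>inf_mat_ring\<^esub> z_minus K = \<one>\<^bsub>inf_mat_ring\<^esub>"
      by (intro ext) (simp add: mult_z_minus[OF K] L(1) one)
    moreover have "z_minus K \<otimes>\<^bsub>inf_mat_ring\<^esub> L = \<one>\<^bsub>inf_mat_ring\<^esub>"
      by (intro ext) (simp add: z_minus_mult[OF K] left_resolvent_imp_right_resolvent[OF K L(1,2)] one)
    ultimately show "L \<in> carrier inf_mat_ring \<and> z_minus K \<otimes>\<^bsub>inf_mat_ring\<^esub> L = \<one>\<^bsub>inf_mat_ring\<^esub> \<and>
        L \<otimes>\<^bsub>inf_mat_ring\<^esub> z_minus K = \<one>\<^bsub>inf_mat_ring\<^esub>" by blast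
  next
    fix y
    assume y: "y \<in> carrier inf_mat_ring \<and> z_minus K \<otimes>\<^bsub>inf_mat_ring\<^esub> y = \<one>\<^bsub>inf_mat_ring\<^esub> \<and>
        y \<otimes>\<^bsub>inf_mat_ring\<^esub> z_minus K = \<one>\<^bsub>inf_mat_ring\<^esub>"
    then obtain d where d: "\<And>i j n. d < n \<Longrightarrow> zcoeff (y i j) n = 0"
      unfolding inf_mat_ring_def by auto
    \<comment> \<open>The equation \<open>y (z - K) = 1\<close> is the row equation for each row of
      \<open>y\<close>, and the carrier supplies the uniform degree bound.\<close>
    show "y = L"
    proof (intro ext row_equation_unique[OF K _ _ L(1,2)])
      fix i j
      show "zvar * y i j = (if i = j then 1 else 0) + (\<Sum>k\<le>j + p. y i k * K k j)"
        using y mult_z_minus[OF K, of y i j] by (simp add: inf_mat_ring_def algebra_simps)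
      have "fls_nth (y i j) m = 0" if "m < - d" for m
        using d[of "- m" i j] that by (simp add: zcoeff_def)
      then show "vanishes_below (- d) (y i j)" by (simp add: vanishes_below_def)
    qed
  qed
  with L show ?eq ?vb by simp_all
qed

section \<open>Deleting the first row and column\<close>

lemma banded_shift: "banded p q K \<Longrightarrow> banded p q (\<lambda>i j. K (Suc i) (Suc j))"
  unfolding banded_def by (metis Suc_le_mono add_Suc)

text \<open>Schur complement. Write \<open>u\<close> for row 0 and \<open>v\<close> for column 0 of
  \<open>K\<close> without the corner. The blocks of \<open>Z (z - K) = 1\<close> give
  \<open>Z i (Suc j)\<close> through \<open>u N\<close>, and then column 0 through the scalar
  \<open>z - K 0 0 - u N v\<close>. The band cuts \<open>u\<close> to \<open>q\<close> entries and
  \<open>v\<close> to \<open>p\<close>.\<close>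

lemma
  assumes K: "banded p q K"
  defines "Z \<equiv> resolvent K" and "N \<equiv> resolvent (\<lambda>i j. K (Suc i) (Suc j))"
  shows resolvent_Suc_col:
      "Z i (Suc j) = (if i = 0 then 0 else N (i - 1) j) + Z i 0 * (\<Sum>k<q. K 0 (Suc k) * N k j)"
      (is ?thesis1)
    and resolvent_0_col:
      "Z i 0 * (zvar - K 0 0 - (\<Sum>l<p. (\<Sum>k<q. K 0 (Suc k) * N k l) * K (Suc l) 0)) =
       (if i = 0 then 1 else \<Sum>l<p. N (i - 1) l * K (Suc l) 0)" (is ?thesis2)
proof -
  have K': "banded p q (\<lambda>i j. K (Suc i) (Suc j))" by (rule banded_shift[OF K])
  note Z = resolvent_row[OF K, folded Z_def] and N = resolvent_row[OF K', folded N_def]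
  define uN where "uN j = (\<Sum>k<q. K 0 (Suc k) * N k j)" for j
  define Y where "Y j = (if i = 0 then 0 else N (i - 1) j) + Z i 0 * uN j" for j
  \<comment> \<open>Row \<open>i\<close> of \<open>Z\<close> without its first entry solves the row
    equation of the shifted matrix, with the contribution of \<open>Z i 0\<close> moved into
    \<open>f\<close>; \<open>Y\<close> solves the same one.\<close>
  define f where "f j = (if i = Suc j then 1 else 0) + Z i 0 * K 0 (Suc j)" for j
  have col: "Z i (Suc j) = Y j" for j
  proof (rule row_equation_unique[OF K', where f = f])
    fix j
    show "zvar * Z i (Suc j) = f j + (\<Sum>k\<le>j + p. Z i (Suc k) * K (Suc k) (Suc j))"
      unfolding Z(1) f_def add_Suc sum.atMost_Suc_shift by simp
    show "vanishes_below 1 (Z i (Suc j))" by (rule Z(2))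
    have u: "(\<Sum>k<q. K 0 (Suc k) * (if k = j then 1 else 0)) = K 0 (Suc j)"
      using bandedD(2)[OF K] by (simp add: if_distrib[of "\<lambda>x. _ * x"] cong: if_cong)
    have "zvar * uN j = (\<Sum>k<q. K 0 (Suc k) * (zvar * N k j))"
      by (simp only: uN_def sum_distrib_left mult.left_commute)
    also have "\<dots> = K 0 (Suc j) + (\<Sum>k<q. \<Sum>l\<le>j + p. K 0 (Suc k) * N k l * K (Suc l) (Suc j))"
      unfolding N distrib_left sum.distrib u by (simp only: sum_distrib_left mult.assoc)
    also have "(\<Sum>k<q. \<Sum>l\<le>j + p. K 0 (Suc k) * N k l * K (Suc l) (Suc j)) =
        (\<Sum>l\<le>j + p. uN l * K (Suc l) (Suc j))"
      by (subst sum.swap) (simp only: uN_def sum_distrib_right)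
    finally have uN_row: "zvar * uN j =
        K 0 (Suc j) + (\<Sum>l\<le>j + p. uN l * K (Suc l) (Suc j))" .
    have "zvar * Y j = zvar * (if i = 0 then 0 else N (i - 1) j) +
        Z i 0 * (zvar * uN j)"
      by (simp only: Y_def distrib_left mult.left_commute)
    also have "zvar * (if i = 0 then 0 else N (i - 1) j) = (if i = Suc j then 1 else 0) +
        (\<Sum>l\<le>j + p. (if i = 0 then 0 else N (i - 1) l) * K (Suc l) (Suc j))"
      using N(1)[of "i - 1" j] by (cases i) simp_all
    finally show "zvar * Y j = f j + (\<Sum>l\<le>j + p. Y l * K (Suc l) (Suc j))"
      unfolding uN_row Y_def f_def
      by (simp only: distrib_left distrib_right sum.distrib sum_distrib_left mult.assoc add_ac)
    show "vanishes_below 0 (Y j)"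
      unfolding Y_def uN_def using bandedD(1)[OF K] vanishes_below_mono[OF Z(2)] vanishes_below_mono[OF N(2)]
      by (intro vanishes_below_add vanishes_below_mult_0 vanishes_below_sum) simp_all
  qed
  then show ?thesis1 by (simp add: Y_def uN_def)
  \<comment> \<open>In column 0 of the row equation, \<open>col\<close> replaces the entries
    \<open>Z i (Suc l)\<close>; collecting the multiples of \<open>Z i 0\<close> gives the Schur
    complement.\<close>
  have "zvar * Z i 0 = (if i = 0 then 1 else 0) + (\<Sum>k\<le>p. Z i k * K k 0)"
    using Z(1)[of i 0] by simp
  also have "(\<Sum>k\<le>p. Z i k * K k 0) = Z i 0 * K 0 0 + (\<Sum>l<p. Y l * K (Suc l) 0)"
    by (simp add: sum.atMost_shift col)
  also have "(\<Sum>l<p. Y l * K (Suc l) 0) = (\<Sum>l<p. (if i = 0 then 0 else N (i - 1) l) * K (Suc l) 0) +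
      Z i 0 * (\<Sum>l<p. uN l * K (Suc l) 0)"
    by (simp only: Y_def distrib_right sum.distrib sum_distrib_left mult.assoc)
  finally show ?thesis2
    unfolding uN_def[symmetric] by (cases i) (simp_all add: algebra_simps)
qed

text \<open>By the Schur formulas, \<open>T_mat\<close> turns row 0 of \<open>Z\<close> into
  \<open>- u N\<close>, column 0 into \<open>N v\<close>, the corner into its inverse
  \<open>z - K 0 0 - u N v\<close>, and the rest into \<open>N\<close>. The sum on the right has the
  same entries, because the outer factors only overwrite the last row and the last column of
  \<open>N\<close>.\<close>

lemma T_mat_resolvent:
  assumes K: "banded p q K" and p: "p \<ge> 1" and q: "q \<ge> 1"
  defines "Z \<equiv> resolvent K" and "N \<equiv> resolvent (\<lambda>i j. K (Suc i) (Suc j))"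
  shows "is_pseudo_quotient (mat q p (\<lambda>(i, j). Z i j))
    (mat q p (\<lambda>(i, j). if i = q - 1 \<and> j = p - 1 then zvar - K 0 0 else 0) +
     mat q q (\<lambda>(i, j). if i = q - 1 then - K 0 (Suc j) else if i = j then 1 else 0) *
     mat q p (\<lambda>(i, j). N i j) *
     mat p p (\<lambda>(i, j). if j = p - 1 then K (Suc i) 0 else if i = j then 1 else 0))"
    (is "is_pseudo_quotient ?Z (?b + ?bp * ?N * ?bm)")
proof -
  define uN where "uN j = (\<Sum>k<q. K 0 (Suc k) * N k j)" for j
  define Nv where "Nv i = (\<Sum>l<p. N i l * K (Suc l) 0)" for i
  define s where "s = zvar - K 0 0 - (\<Sum>l<p. uN l * K (Suc l) 0)"
  have col: "Z 0 (Suc j) = Z 0 0 * uN j" "Z (Suc i) (Suc j) = N i j + Z (Suc i) 0 * uN j" for i j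
    using resolvent_Suc_col[OF K, of 0 j] resolvent_Suc_col[OF K, of "Suc i" j]
    by (simp_all add: Z_def N_def uN_def)
  have col0: "Z 0 0 * s = 1" "Z (Suc i) 0 * s = Nv i" for i
    using resolvent_0_col[OF K, of 0] resolvent_0_col[OF K, of "Suc i"]
    by (simp_all add: Z_def N_def uN_def s_def Nv_def)
  \<comment> \<open>The corner is invertible with inverse \<open>s\<close>, which makes the
    pseudo-quotient defined.\<close>
  have Z0: "Z 0 0 \<noteq> 0" using col0(1) by auto
  have s: "s = 1 / Z 0 0" using col0(1) Z0 by (simp add: field_simps)
  have Nv: "Nv i = Z (Suc i) 0 / Z 0 0" for i using col0(2)[of i] s by simp
  have bpN: "?bp * ?N = mat q p (\<lambda>(i, j). if i = q - 1 then - uN j else N i j)"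
    by (rule eq_matI)
      (auto simp: scalar_prod_def uN_def sum_negf lessThan_atLeast0 if_distrib[of "\<lambda>x. x * _"] cong: if_cong)
  have bpNbm: "?bp * ?N * ?bm = mat q p (\<lambda>(i, j).
      if i = q - 1 then if j = p - 1 then - (\<Sum>l<p. uN l * K (Suc l) 0) else - uN j
      else if j = p - 1 then Nv i else N i j)"
    unfolding bpN
    by (rule eq_matI)
      (auto simp: scalar_prod_def Nv_def sum_negf lessThan_atLeast0 if_distrib[of "\<lambda>x. _ * x"] cong: if_cong)
  have "?b + ?bp * ?N * ?bm = T_mat ?Z"
    unfolding bpNbm
  proof (rule eq_matI)
    fix i j
    assume "i < dim_row (T_mat ?Z)" "j < dim_col (T_mat ?Z)"
    then have ij: "i < q" "j < p" by (simp_all add: T_mat_def)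
    consider "i < q - 1" "j < p - 1" | "i = q - 1" "j < p - 1" | "i < q - 1" "j = p - 1"
      | "i = q - 1" "j = p - 1" using ij by linarith
    then show "(?b + mat q p (\<lambda>(i, j).
      if i = q - 1 then if j = p - 1 then - (\<Sum>l<p. uN l * K (Suc l) 0) else - uN j
      else if j = p - 1 then Nv i else N i j)) $$ (i, j) = T_mat ?Z $$ (i, j)"
      using p q ij Z0
      by cases (simp_all add: T_mat_def col Nv s[unfolded s_def, symmetric] field_simps)
  qed (simp_all add: T_mat_def)
  then show ?thesis
    using p q Z0 by (simp add: is_pseudo_quotient_def)
qed

section \<open>Uniqueness of pseudo-quotients and their composition\<close>

lemma is_pseudo_quotient_unique:
  assumes A: "is_pseudo_quotient A B" and A': "is_pseudo_quotient A' B"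
  shows "A = A'"
proof -
  define q p where "q = dim_row A" and "p = dim_col A"
  have dim: "dim_row A' = q" "dim_col A' = p" "q > 0" "p > 0"
  proof -
    have "dim_row (T_mat A) = dim_row (T_mat A')" "dim_col (T_mat A) = dim_col (T_mat A')"
      using A A' by (simp_all add: is_pseudo_quotient_def)
    then show "dim_row A' = q" "dim_col A' = p" by (simp_all add: T_mat_def q_def p_def Let_def)
    show "q > 0" "p > 0" using A by (simp_all add: is_pseudo_quotient_def q_def p_def)
  qed
  have nz: "A $$ (0, 0) \<noteq> 0" "A' $$ (0, 0) \<noteq> 0" and T: "T_mat A = T_mat A'"
    using A A' by (simp_all add: is_pseudo_quotient_def)
  have T': "T_mat A $$ (i, j) = T_mat A' $$ (i, j)" for i j using T by simp
  note simps = T_mat_def q_def[symmetric] p_def[symmetric] dim Let_def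
  \<comment> \<open>The entries of \<open>A\<close> are recovered from \<open>T_mat A\<close> in
    turn: the corner from the bottom right entry, then row 0 and column 0, then the rest.\<close>
  have A00: "A $$ (0, 0) = A' $$ (0, 0)"
    using T'[of "q - 1" "p - 1"] dim nz by (simp add: simps)
  have A0: "A $$ (0, Suc j) = A' $$ (0, Suc j)" if "Suc j < p" for j
    using T'[of "q - 1" j] dim nz that by (simp add: simps A00 less_diff_conv)
  have A1: "A $$ (Suc i, 0) = A' $$ (Suc i, 0)" if "Suc i < q" for i
    using T'[of i "p - 1"] dim nz that by (simp add: simps A00 less_diff_conv)
  have A2: "A $$ (Suc i, Suc j) = A' $$ (Suc i, Suc j)" if "Suc i < q" "Suc j < p" for i j
    using T'[of i j] dim nz that by (simp add: simps A00 A0 A1 less_diff_conv)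
  show ?thesis
  proof (rule eq_matI)
    fix i j assume "i < dim_row A'" "j < dim_col A'"
    then show "A $$ (i, j) = A' $$ (i, j)"
      using A00 A0 A1 A2 dim by (cases i; cases j) auto
  qed (simp_all add: dim q_def p_def)
qed

lemma pseudo_quotient_eq_Some:
  assumes "is_pseudo_quotient A B"
  shows "pseudo_quotient B = Some A"
proof -
  have "(THE A. is_pseudo_quotient A B) = A"
    by (rule the_equality[where P = "\<lambda>A. is_pseudo_quotient A B", OF assms])
      (rule is_pseudo_quotient_unique[OF _ assms])
  then show ?thesis using assms by (auto simp: pseudo_quotient_def)
qed

lemma foldr_map_comp: "foldr (\<circ>\<^sub>m) ts (g \<circ>\<^sub>m h) = foldr (\<circ>\<^sub>m) ts g \<circ>\<^sub>m h"
  by (induction ts) (simp_all add: map_comp_def fun_eq_iff split: option.split)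

text \<open>Induction at the inner end: the innermost map \<open>t k\<close> turns
  \<open>R (Suc k)\<close> into \<open>R k\<close>, the argument of the shorter composition.\<close>

lemma compose_first_chain:
  assumes "\<And>r. t r (R (Suc r)) = Some (R r)"
  shows "compose_first k t (R k) = Some (R 0)"
proof (induction k)
  case (Suc k)
  have "Some \<circ>\<^sub>m t k = t k" "t k \<circ>\<^sub>m Some = t k"
    by (simp_all add: map_comp_def fun_eq_iff split: option.split)
  then have "compose_first (Suc k) t = compose_first k t \<circ>\<^sub>m t k"
    using foldr_map_comp[of "map t [0..<k]" Some "t k"] by (simp add: compose_first_def)
  then show ?case using Suc assms by simp
qed (simp add: compose_first_def)

section \<open>Last-step decomposition of path sums\<close>

text \<open>Upward and downward steps both carry the sequence index of their lower end, hence
  \<open>min i j\<close>. This is \<open>h_entry\<close> extended to all integers.\<close>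

definition step_matrix :: "nat \<Rightarrow> nat \<Rightarrow> (int \<Rightarrow> int \<Rightarrow> complex) \<Rightarrow> int \<Rightarrow> int \<Rightarrow> complex" where
  "step_matrix p q a i j = (if - int p \<le> j - i \<and> j - i \<le> int q then a (j - i) (min i j) else 0)"

text \<open>The set \<open>S\<close> of allowed heights treats \<open>W_coeff\<close> (all integers)
  and \<open>V_coeff\<close> (negative integers) together.\<close>

definition paths_in :: "nat \<Rightarrow> nat \<Rightarrow> int set \<Rightarrow> nat \<Rightarrow> int \<Rightarrow> int \<Rightarrow> vertex list set" where
  "paths_in p q S n i j = {vs \<in> paths p q n i j. \<forall>v\<in>set vs. snd v \<in> S}"

definition path_sum ::
  "nat \<Rightarrow> nat \<Rightarrow> (int \<Rightarrow> int \<Rightarrow> complex) \<Rightarrow> int set \<Rightarrow> nat \<Rightarrow> int \<Rightarrow> int \<Rightarrow> complex" where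
  "path_sum p q a S n i j = (\<Sum>\<gamma>\<in>paths_in p q S n i j. path_weight a \<gamma>)"

definition path_series ::
  "nat \<Rightarrow> nat \<Rightarrow> (int \<Rightarrow> int \<Rightarrow> complex) \<Rightarrow> int set \<Rightarrow> int \<Rightarrow> int \<Rightarrow> complex fls" where
  "path_series p q a S i j = fls_X * fps_to_fls (Abs_fps (\<lambda>n. path_sum p q a S n i j))"

lemma W_series_eq: "W_series p q a = path_series p q a UNIV"
  by (simp add: fun_eq_iff W_series_def path_series_def W_coeff_def path_sum_def paths_in_def)

lemma V_series_eq: "V_series p q a = path_series p q a {..-1}"
  by (simp add: fun_eq_iff V_series_def path_series_def V_coeff_def path_sum_def paths_in_def neg_paths_def)

lemma paths_in_0: "paths_in p q S 0 i j = (if i = j \<and> i \<in> S then {[(0, i)]} else {})"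
  by (auto simp: paths_in_def paths_def is_path_def path_length_def le_Suc_eq length_Suc_conv)

lemma paths_in_not_mem: "j \<notin> S \<Longrightarrow> paths_in p q S n i j = {}"
  unfolding paths_in_def paths_def is_path_def by (auto, metis last_in_set snd_conv)

text \<open>The last vertex is split off; the bounds on the last step put the height
  \<open>k\<close> before it between \<open>j - q\<close> and \<open>j + p\<close>.\<close>

lemma paths_in_Suc:
  assumes "j \<in> S"
  shows "paths_in p q S (Suc n) i j =
    (\<Union>k\<in>{j - int q..j + int p} \<inter> S. (\<lambda>vs. vs @ [(Suc n, j)]) ` paths_in p q S n i k)"
    (is "?L = ?R")
proof (rule Set.set_eqI)
  fix vs
  show "vs \<in> ?L \<longleftrightarrow> vs \<in> ?R"
  proof
    assume vs: "vs \<in> ?L"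
    then obtain us w where us: "vs = us @ [w]"
      by (metis (no_types, lifting) is_path_def mem_Collect_eq paths_def paths_in_def rev_exhaust)
    have "us \<noteq> []" "w = (Suc n, j)"
      using vs unfolding us by (auto simp: paths_in_def paths_def path_length_def)
    then have step: "is_step p q (last us) (Suc n, j)"
      using vs unfolding us by (auto simp: paths_in_def paths_def is_path_def successively_append_iff)
    then have "us \<in> paths_in p q S n i (snd (last us))"
      using vs \<open>us \<noteq> []\<close> unfolding us
      by (auto simp: paths_in_def paths_def is_path_def path_length_def successively_append_iff
          is_step_def prod_eq_iff)
    moreover have "snd (last us) \<in> {j - int q..j + int p} \<inter> S"
      using step vs \<open>us \<noteq> []\<close> unfolding us by (auto simp: is_step_def paths_in_def)
    ultimately show "vs \<in> ?R"
      unfolding us using \<open>w = (Suc n, j)\<close> by blast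
  next
    assume "vs \<in> ?R"
    then obtain k us where "k \<in> {j - int q..j + int p}" "us \<in> paths_in p q S n i k"
      "vs = us @ [(Suc n, j)]" by blast
    then show "vs \<in> ?L"
      using assms
      by (auto simp: paths_in_def paths_def is_path_def path_length_def successively_append_iff
          is_step_def Suc_diff_le Suc_leI)
  qed
qed

lemma finite_paths_in: "finite (paths_in p q S n i j)"
proof (induction n arbitrary: j)
  case (Suc n)
  then show ?case by (cases "j \<in> S") (simp_all add: paths_in_Suc paths_in_not_mem)
qed (simp add: paths_in_0)

lemma path_weight_snoc:
  assumes "vs \<noteq> []"
  shows "path_weight a (vs @ [w]) = path_weight a vs * step_weight a (last vs) w"
proof -
  obtain n where n: "length vs = Suc n" using assms by (cases vs) auto
  then show ?thesis
    using assms by (simp add: path_weight_def path_length_def nth_append last_conv_nth)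
qed

lemma path_sum_Suc:
  assumes "j \<in> S"
  shows "path_sum p q a S (Suc n) i j =
    (\<Sum>k\<in>{j - int q..j + int p} \<inter> S. path_sum p q a S n i k * step_matrix p q a k j)"
proof -
  have last: "vs \<noteq> [] \<and> last vs = (n, k)" if "vs \<in> paths_in p q S n i k" for vs k
    using that by (simp add: paths_in_def paths_def is_path_def)
  have "path_sum p q a S (Suc n) i j = (\<Sum>k\<in>{j - int q..j + int p} \<inter> S.
      \<Sum>\<gamma>\<in>(\<lambda>vs. vs @ [(Suc n, j)]) ` paths_in p q S n i k. path_weight a \<gamma>)"
    unfolding path_sum_def paths_in_Suc[OF assms]
  proof (rule sum.UNION_disjoint)
    \<comment> \<open>The union is disjoint because the last vertex of a path determines
      \<open>k\<close>.\<close>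
    have "k = k'" if "vs \<in> paths_in p q S n i k" "vs \<in> paths_in p q S n i k'" for vs k k'
      using last[OF that(1)] last[OF that(2)] by simp
    then show "\<forall>k\<in>{j - int q..j + int p} \<inter> S. \<forall>k'\<in>{j - int q..j + int p} \<inter> S. k \<noteq> k' \<longrightarrow>
        (\<lambda>vs. vs @ [(Suc n, j)]) ` paths_in p q S n i k \<inter>
        (\<lambda>vs. vs @ [(Suc n, j)]) ` paths_in p q S n i k' = {}"
      by blast
  qed (simp_all add: finite_paths_in)
  also have "\<dots> = (\<Sum>k\<in>{j - int q..j + int p} \<inter> S. path_sum p q a S n i k * step_matrix p q a k j)"
  proof (rule sum.cong)
    fix k assume k: "k \<in> {j - int q..j + int p} \<inter> S"
    have "(\<Sum>\<gamma>\<in>(\<lambda>vs. vs @ [(Suc n, j)]) ` paths_in p q S n i k. path_weight a \<gamma>) =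
        (\<Sum>\<gamma>\<in>paths_in p q S n i k. path_weight a (\<gamma> @ [(Suc n, j)]))"
      by (subst sum.reindex) (auto simp: inj_on_def)
    also have "\<dots> = (\<Sum>\<gamma>\<in>paths_in p q S n i k. path_weight a \<gamma> * step_matrix p q a k j)"
      using last k by (intro sum.cong)
        (auto simp: path_weight_snoc step_weight_def step_matrix_def Let_def min_def)
    finally show "(\<Sum>\<gamma>\<in>(\<lambda>vs. vs @ [(Suc n, j)]) ` paths_in p q S n i k. path_weight a \<gamma>) =
        path_sum p q a S n i k * step_matrix p q a k j"
      by (simp add: path_sum_def sum_distrib_right)
  qed simp
  finally show ?thesis .
qed

text \<open>\<open>step_matrix\<close> vanishes outside the band, so the range of summation can be
  any finite \<open>T\<close> that contains the possible predecessors; this lets each application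
  choose a convenient index set.\<close>

lemma path_series_row:
  assumes j: "j \<in> S" and T: "finite T" "{j - int q..j + int p} \<inter> S \<subseteq> T" "T \<subseteq> S"
  shows "zvar * path_series p q a S i j = (if i = j then 1 else 0) +
    (\<Sum>k\<in>T. path_series p q a S i k * fls_const (step_matrix p q a k j))"
proof -
  define F where "F k = Abs_fps (\<lambda>n. path_sum p q a S n i k)" for k
  have "path_sum p q a S (Suc n) i j = (\<Sum>k\<in>T. path_sum p q a S n i k * step_matrix p q a k j)" for n
    unfolding path_sum_Suc[OF j]
    using T by (intro sum.mono_neutral_left) (auto simp: step_matrix_def)
  moreover have "path_sum p q a S 0 i j = (if i = j then 1 else 0)"
    using j by (auto simp: path_sum_def paths_in_0 path_weight_def path_length_def)
  ultimately have "fps_nth (F j) n = fps_nth ((if i = j then 1 else 0) +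
      (\<Sum>k\<in>T. fps_X * F k * fps_const (step_matrix p q a k j))) n" for n
    by (cases n) (simp_all add: F_def fps_sum_nth mult.assoc)
  then have "F j = (if i = j then 1 else 0) +
      (\<Sum>k\<in>T. fps_X * F k * fps_const (step_matrix p q a k j))"
    by (rule fps_ext)
  then have "fps_to_fls (F j) = (if i = j then 1 else 0) +
      (\<Sum>k\<in>T. fls_X * fps_to_fls (F k) * fls_const (step_matrix p q a k j))"
    by (simp add: fps_to_fls_sum fls_times_fps_to_fls)
  then show ?thesis by (simp add: path_series_def F_def)
qed

lemma vanishes_below_path_series [simp]: "d \<le> 1 \<Longrightarrow> vanishes_below d (path_series p q a S i j)"
  by (simp add: path_series_def)

section \<open>Eliminating the negative indices\<close>

text \<open>A path from \<open>i \<ge> 0\<close> to \<open>k < 0\<close> is split at its last vertex \<open>m \<ge> 0\<close>.\<close>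

lemma W_series_neg:
  fixes k :: int
  assumes "k < 0"
  shows "W_series p q a (int i) k = (\<Sum>m<p. \<Sum>l\<in>{1..int p}.
    W_series p q a (int i) (int m) * fls_const (step_matrix p q a (int m) (- l)) * V_series p q a (- l) k)"
proof -
  define W where "W = W_series p q a (int i)"
  define V where "V = V_series p q a"
  define H where "H k j = fls_const (step_matrix p q a k j)" for k j
  \<comment> \<open>On negative indices \<open>W\<close> and \<open>Y\<close> solve the same row
    equation, whose inhomogeneous term collects the steps from some \<open>m >= 0\<close> down to
    \<open>k\<close>; hence they agree.\<close>
  define Y where "Y k = (\<Sum>m<p. \<Sum>l\<in>{1..int p}. W (int m) * H (int m) (- l) * V (- l) k)" for k
  define T where "T k = {k - int q..min (-1) (k + int p)}" for k
  have H0: "H m l = 0" if "m + int q < l \<or> l + int p < m" for m l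
    using that by (auto simp: H_def step_matrix_def)
  have W: "zvar * W k = (\<Sum>m<p. W (int m) * H (int m) k) + (\<Sum>l\<in>T k. W l * H l k)" if "k < 0" for k
  proof -
    have "zvar * W k = (\<Sum>l\<in>int ` {..<p} \<union> T k. W l * H l k)"
      unfolding W_def W_series_eq H_def
    proof (subst path_series_row)
      show "{k - int q..k + int p} \<inter> UNIV \<subseteq> int ` {..<p} \<union> T k"
      proof
        fix x assume x: "x \<in> {k - int q..k + int p} \<inter> UNIV"
        show "x \<in> int ` {..<p} \<union> T k"
        proof (cases "x < 0")
          case False
          \<comment> \<open>A step down from \<open>x >= 0\<close> to \<open>k < 0\<close> has
            length at most \<open>p\<close>, so it starts below \<open>p\<close>.\<close>
          then have "x = int (nat x)" "nat x < p" using x that by auto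
          then show ?thesis by blast
        qed (use x in \<open>auto simp: T_def\<close>)
      qed
    qed (use that in \<open>auto simp: T_def\<close>)
    also have "\<dots> = (\<Sum>l\<in>int ` {..<p}. W l * H l k) + (\<Sum>l\<in>T k. W l * H l k)"
      by (rule sum.union_disjoint) (auto simp: T_def)
    finally show ?thesis by (simp add: sum.reindex)
  qed
  have V: "zvar * V l k = (if l = k then 1 else 0) + (\<Sum>l'\<in>T k. V l l' * H l' k)" if "k < 0" for l k
    unfolding V_def V_series_eq H_def
    by (rule path_series_row) (use that in \<open>auto simp: T_def\<close>)
  have Y: "zvar * Y k = (\<Sum>m<p. W (int m) * H (int m) k) + (\<Sum>l\<in>T k. Y l * H l k)" if "k < 0" for k
  proof -
    \<comment> \<open>If \<open>k < - p\<close>, no \<open>l\<close> matches, but then no single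
      step leads from \<open>m\<close> to \<open>k\<close> either and both sides vanish.\<close>
    have delta: "(\<Sum>l\<in>{1..int p}. W (int m) * H (int m) (- l) * (if - l = k then 1 else 0)) =
        W (int m) * H (int m) k" for m
    proof -
      have "- l = k \<longleftrightarrow> l = - k" for l :: int by auto
      then show ?thesis
        using H0[of "int m" k] that by (auto simp: if_distrib[of "\<lambda>x. _ * x"] cong: if_cong)
    qed
    have "zvar * Y k = (\<Sum>m<p. \<Sum>l\<in>{1..int p}. W (int m) * H (int m) (- l) * (zvar * V (- l) k))"
      by (simp only: Y_def sum_distrib_left mult_ac)
    also have "\<dots> = (\<Sum>m<p. W (int m) * H (int m) k) +
        (\<Sum>m<p. \<Sum>l\<in>{1..int p}. \<Sum>l'\<in>T k. W (int m) * H (int m) (- l) * V (- l) l' * H l' k)"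
      unfolding V[OF that] distrib_left sum.distrib delta by (simp only: sum_distrib_left mult.assoc)
    also have "(\<Sum>m<p. \<Sum>l\<in>{1..int p}. \<Sum>l'\<in>T k. W (int m) * H (int m) (- l) * V (- l) l' * H l' k) =
        (\<Sum>l\<in>T k. Y l * H l k)"
      unfolding Y_def sum_distrib_right
      by (rule trans[OF sum.cong[OF refl sum.swap] sum.swap])
    finally show ?thesis .
  qed
  have "W k - Y k = 0"
  proof (rule homogeneous_row_equation[where I = "{..<0}" and A = H and S = T and d = 1])
    show "zvar * (W k - Y k) = (\<Sum>l\<in>T k. (W l - Y l) * H l k)" if "k \<in> {..<0}" for k
      using that by (simp add: right_diff_distrib W Y left_diff_distrib sum_subtractf)
    show "vanishes_below 1 (W k - Y k)" for k
      unfolding Y_def W_def V_def W_series_eq V_series_eq H_def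
      by (intro vanishes_below_diff vanishes_below_sum vanishes_below_mult_0) simp_all
  qed (use assms in \<open>auto simp: T_def H_def\<close>)
  then show ?thesis by (simp add: Y_def W_def H_def V_def)
qed

text \<open>An entry of \<open>K\<close> is a direct step plus all excursions: down to
  \<open>- l\<close>, a negative path to \<open>- m\<close>, and back up to \<open>j\<close>. The
  zeros of \<open>step_matrix\<close> make the ranges uniform and cover the entries outside the
  corner block.\<close>

lemma K_mat_eq:
  "K_mat p q a i j = fls_const (step_matrix p q a (int i) (int j)) +
    (\<Sum>l\<in>{1..int p}. \<Sum>m\<in>{1..int q}. fls_const (step_matrix p q a (int i) (- l)) *
      V_series p q a (- l) (- m) * fls_const (step_matrix p q a (- m) (int j)))"
proof -
  define f where "f l m = fls_const (step_matrix p q a (int i) (- l)) *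
      V_series p q a (- l) (- m) * fls_const (step_matrix p q a (- m) (int j))" for l m
  have f0: "f l m = 0" if "l + int i > int p \<or> m + int j > int q" for l m
    using that by (auto simp: f_def step_matrix_def)
  have fe: "f l m = fls_const (a (- (l + int i)) (- l) * a (m + int j) (- m)) * V_series p q a (- l) (- m)"
    if "1 \<le> l" "l \<le> int p - int i" "1 \<le> m" "m \<le> int q - int j" for l m
  proof -
    have "min (int i) (- l) = - l" "min (- m) (int j) = - m" using that by auto
    then show ?thesis
      using that unfolding f_def step_matrix_def fls_const_mult_const[symmetric]
      by (simp del: fls_const_mult_const add: add.commute)
  qed
  have "(\<Sum>l=1..int p. \<Sum>m=1..int q. f l m) = (\<Sum>l=1..int p - int i. \<Sum>m=1..int q. f l m)"
    using f0 by (intro sum.mono_neutral_right) auto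
  also have "\<dots> = (\<Sum>l=1..int p - int i. \<Sum>m=1..int q - int j. f l m)"
    using f0 by (intro sum.cong sum.mono_neutral_right) auto
  also have "\<dots> = (\<Sum>l=1..int p - int i. \<Sum>m=1..int q - int j.
      fls_const (a (- (l + int i)) (- l) * a (m + int j) (- m)) * V_series p q a (- l) (- m))"
    by (intro sum.cong refl fe) auto
  finally have "(\<Sum>l=1..int p. \<Sum>m=1..int q. f l m) = \<dots>" .
  moreover have "h_entry p q a i j = step_matrix p q a (int i) (int j)"
    by (simp add: h_entry_def step_matrix_def of_nat_min)
  ultimately show ?thesis
    unfolding f_def[symmetric] by (auto simp: K_mat_def)
qed

text \<open>A path ending at \<open>j >= 0\<close> comes from a height \<open>k >= 0\<close> or from
  some \<open>- m\<close>. Replacing \<open>W (- m)\<close> by \<open>W_series_neg\<close> gathers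
  the excursions below zero into the correction terms of \<open>K_mat\<close>.\<close>

lemma W_series_row:
  "zvar * W_series p q a (int i) (int j) = (if i = j then 1 else 0) +
    (\<Sum>k\<le>j + p. W_series p q a (int i) (int k) * K_mat p q a k j)"
proof -
  define W where "W = W_series p q a (int i)"
  define V where "V = V_series p q a"
  define H where "H k j = fls_const (step_matrix p q a k j)" for k j
  have H0: "H m l = 0" if "m + int q < l \<or> l + int p < m" for m l
    using that by (auto simp: H_def step_matrix_def)
  define E where "E k = (\<Sum>l\<in>{1..int p}. \<Sum>m\<in>{1..int q}. H (int k) (- l) * V (- l) (- m) * H (- m) (int j))" for k
  have K: "K_mat p q a k j = H (int k) (int j) + E k" for k
    by (simp add: K_mat_eq H_def V_def E_def)
  have E0: "E k = 0" if "p \<le> k" for k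
    unfolding E_def using that by (intro sum.neutral) (auto simp: H0)
  have "zvar * W (int j) = (if i = j then 1 else 0) +
      (\<Sum>k\<in>int ` {..j + p} \<union> uminus ` {1..int q}. W k * H k (int j))"
    unfolding W_def W_series_eq H_def
  proof (subst path_series_row)
    show "{int j - int q..int j + int p} \<inter> UNIV \<subseteq> int ` {..j + p} \<union> uminus ` {1..int q}"
    proof
      fix x assume x: "x \<in> {int j - int q..int j + int p} \<inter> UNIV"
      show "x \<in> int ` {..j + p} \<union> uminus ` {1..int q}"
      proof (cases "x < 0")
        case True
        then have "x = - (- x)" "- x \<in> {1..int q}" using x by auto
        then show ?thesis by blast
      next
        case False
        then have "x = int (nat x)" "nat x \<le> j + p" using x by auto
        then show ?thesis by blast
      qed
    qed
  qed auto
  also have "(\<Sum>k\<in>int ` {..j + p} \<union> uminus ` {1..int q}. W k * H k (int j)) =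
      (\<Sum>k\<in>int ` {..j + p}. W k * H k (int j)) + (\<Sum>k\<in>uminus ` {1..int q}. W k * H k (int j))"
    by (rule sum.union_disjoint) auto
  also have "(\<Sum>k\<in>int ` {..j + p}. W k * H k (int j)) = (\<Sum>k\<le>j + p. W (int k) * H (int k) (int j))"
    by (simp add: sum.reindex)
  also have "(\<Sum>k\<in>uminus ` {1..int q}. W k * H k (int j)) = (\<Sum>m\<in>{1..int q}. W (- m) * H (- m) (int j))"
    by (subst sum.reindex) simp_all
  also have "\<dots> = (\<Sum>m\<in>{1..int q}. \<Sum>k<p. \<Sum>l\<in>{1..int p}.
      W (int k) * (H (int k) (- l) * V (- l) (- m) * H (- m) (int j)))"
    unfolding W_def H_def V_def
    by (intro sum.cong refl, subst W_series_neg) (simp_all add: sum_distrib_right mult.assoc)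
  also have "\<dots> = (\<Sum>k<p. W (int k) * E k)"
    unfolding E_def sum_distrib_left
    by (rule trans[OF sum.swap sum.cong[OF refl sum.swap]])
  \<comment> \<open>No excursion starts at \<open>k >= p\<close>, so the range can be enlarged to
    that of the direct steps.\<close>
  also have "\<dots> = (\<Sum>k\<le>j + p. W (int k) * E k)"
    using E0 by (intro sum.mono_neutral_left) auto
  finally show ?thesis
    by (simp add: K W_def distrib_left sum.distrib)
qed

text \<open>The corrections live in the block \<open>i < p\<close>, \<open>j < q\<close>, which lies
  inside the band.\<close>

lemma banded_K_mat: "banded p q (K_mat p q a)"
  unfolding banded_def
proof (intro allI conjI impI)
  fix i j
  show "vanishes_below 0 (K_mat p q a i j)"
    unfolding K_mat_eq V_series_eq
    by (intro vanishes_below_add vanishes_below_sum vanishes_below_mult_0) simp_all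
  assume nz: "K_mat p q a i j \<noteq> 0"
  have "j \<le> i + q \<and> i \<le> j + p"
  proof (cases "i < p \<and> j < q")
    case False
    then have "h_entry p q a i j \<noteq> 0" using nz by (auto simp: K_mat_def)
    then show ?thesis by (auto simp: h_entry_def split: if_splits)
  qed simp
  then show "j \<le> i + q" "i \<le> j + p" by simp_all
qed

section \<open>Remainders, coefficients and the continued fraction\<close>

lemma banded_K_trunc: "banded p q (K_trunc p q a r)"
  using banded_K_mat[of p q a] unfolding banded_def K_trunc_def by (metis add.assoc add_le_cancel_left)

text \<open>This makes \<open>G\<close> the end of the chain of remainders: rows of
  \<open>W_series\<close> and of the resolvent of \<open>K_mat\<close> solve the same row
  equation.\<close>

lemma G_rem_0: "G_rem p q a 0 = G_mat p q a"
proof -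
  have "W_series p q a (int i) (int j) = resolvent (K_mat p q a) i j" for i j
  proof (rule row_equation_unique[OF banded_K_mat, where f = "\<lambda>j. if i = j then 1 else 0"])
    show "vanishes_below 1 (W_series p q a (int i) (int j))" for j
      by (simp add: W_series_eq)
  qed (rule W_series_row resolvent_row[OF banded_K_mat])+
  moreover have "K_trunc p q a 0 = K_mat p q a" by (simp add: K_trunc_def fun_eq_iff)
  ultimately show ?thesis by (simp add: G_rem_def G_mat_def zeta_def)
qed

text \<open>The case distinctions agree: \<open>d_coeff\<close> has its correction sum exactly when
  the entry lies in the corner block of \<open>K_mat\<close>.\<close>

lemma d_coeff_eq_row:
  assumes "i \<le> q"
  shows "d_coeff p q a (int k) (int i) = K_mat p q a k (k + i)"
proof (cases "k < p \<and> k + i < q")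
  case True
  then have "\<not> int k \<ge> int (min p q)" "int i \<le> int q - int k - 1" by auto
  with True assms show ?thesis
    by (simp add: d_coeff_def K_mat_def h_entry_def add.assoc)
next
  case False
  then have "d_coeff p q a (int k) (int i) = fls_const (a (int i) (int k))"
    by (simp add: d_coeff_def) linarith
  with False assms show ?thesis by (auto simp: K_mat_def h_entry_def)
qed

lemma d_coeff_eq_col:
  assumes "1 \<le> j" "j \<le> p"
  shows "d_coeff p q a (int k) (- int j) = K_mat p q a (k + j) k"
proof (cases "k + j < p \<and> k < q")
  case True
  then have "\<not> int k \<ge> int (min p q)" "int j \<le> int p - int k - 1" by auto
  with True assms show ?thesis
    by (simp add: d_coeff_def K_mat_def h_entry_def add.assoc Let_def)
next
  case False
  then have "d_coeff p q a (int k) (- int j) = fls_const (a (- int j) (int k))"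
    using assms by (simp add: d_coeff_def Let_def) linarith
  with False assms show ?thesis by (auto simp: K_mat_def h_entry_def add.commute)
qed

text \<open>The three coefficient matrices at level \<open>r\<close> hold the corner, first row and
  first column of \<open>K_trunc p q a r\<close>; deleting that row and column leaves the matrix of
  level \<open>Suc r\<close>, so \<open>T_mat_resolvent\<close> applies.\<close>

lemma tau_G_rem:
  assumes "p \<ge> 1" and "q \<ge> 1"
  shows "tau p q a r (G_rem p q a (Suc r)) = Some (G_rem p q a r)"
proof -
  define K where "K = K_trunc p q a r"
  have b: "beta p q a r = mat q p (\<lambda>(i, j). if i = q - 1 \<and> j = p - 1 then zvar - K 0 0 else 0)"
    unfolding beta_def using d_coeff_eq_row[of 0 q p a r]
    by (intro eq_matI) (simp_all add: K_def K_trunc_def)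
  have bp: "beta_plus p q a r =
      mat q q (\<lambda>(i, j). if i = q - 1 then - K 0 (Suc j) else if i = j then 1 else 0)"
    unfolding beta_plus_def
  proof (rule eq_matI, goal_cases)
    case (1 i j)
    then show ?case
      using d_coeff_eq_row[of "Suc j" q p a r] by (simp add: K_def K_trunc_def add.commute)
  qed simp_all
  have bm: "beta_minus p q a r =
      mat p p (\<lambda>(i, j). if j = p - 1 then K (Suc i) 0 else if i = j then 1 else 0)"
    unfolding beta_minus_def
  proof (rule eq_matI, goal_cases)
    case (1 i j)
    then show ?case
      using d_coeff_eq_col[of "Suc i" p q a r] by (simp add: K_def K_trunc_def add.commute)
  qed simp_all
  have "K_trunc p q a (Suc r) = (\<lambda>i j. K (Suc i) (Suc j))"
    by (simp add: K_def K_trunc_def fun_eq_iff)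
  then have "is_pseudo_quotient (G_rem p q a r)
      (beta p q a r + beta_plus p q a r * G_rem p q a (Suc r) * beta_minus p q a r)"
    unfolding b bp bm G_rem_def zeta_def K_def[symmetric]
    using T_mat_resolvent[OF banded_K_trunc assms, of a r] unfolding K_def[symmetric] by simp
  then show ?thesis
    by (simp add: tau_def mcf_step_def pseudo_quotient_eq_Some)
qed

theorem theorem6p4:
  fixes p q :: nat and a :: "int \<Rightarrow> int \<Rightarrow> complex"
  assumes "p \<ge> 1" and "q \<ge> 1"
  shows "(\<forall>k\<ge>1. compose_first k (tau p q a) (G_rem p q a k) = Some (G_mat p q a)) \<and>
         has_formal_mcf (beta p q a) (beta_plus p q a) (beta_minus p q a) (G_rem p q a) (G_mat p q a)"
proof -
  have "compose_first k (tau p q a) (G_rem p q a k) = Some (G_mat p q a)" for k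
    unfolding G_rem_0[symmetric] by (rule compose_first_chain) (rule tau_G_rem[OF assms])
  \<comment> \<open>\<open>tau\<close> is \<open>mcf_step\<close> with these coefficients, so the
    formal expansion is the same family of identities.\<close>
  then show ?thesis
    unfolding has_formal_mcf_def tau_def[symmetric] by blast
qed

end
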